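(* For any $\varepsilon>0$ there exists a positive integer $n_0(\varepsilon)$ such that for every integer $n\ge n_0(\varepsilon)$, \[ \mathcal{S}_n\cap\{\Re\le 0\}\subset D_{1/e+\varepsilon}\cap\{\Re\le 0\}. \]
   Context: For a positive integer $n$ let $\mathcal{P}_n(z):=\sum_{k=0}^n \frac{(nz)^k}{k!}$ (with $0^0=1$) and $\mathcal{S}_n:=\{z\in\mathbb{C} : |\mathcal{P}_n(z)|\le 1\}$. For $\varrho>0$, $D_\varrho:=\{z\in\mathbb{C}: |z|\le\varrho\}$ is the closed disk of radius $\varrho$ centered at $0$, and $\{\Re\le 0\}:=\{z\in\mathbb{C}:\Re(z)\le 0\}$. Here $e$ is Euler's number. *)

theory Defs
  imports "HOL-Analysis.Analysis"
begin

definition scaled_taylor :: "nat \<Rightarrow> complex \<Rightarrow> complex" where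
  "scaled_taylor n z = (\<Sum>k=0..n. (of_nat n * z) ^ k / fact k)"

definition stability_region :: "nat \<Rightarrow> complex set" where
  "stability_region n = {z. norm (scaled_taylor n z) \<le> 1}"

end

theory Submission
  imports Defs
begin

text \<open>
  Write \<open>w = n z\<close> and \<open>T w = (\<Sum>k\<le>n. w ^ k / fact k)\<close>. In the left half-plane \<open>exp w\<close> has modulus
  at most \<open>1\<close>, so \<open>norm (T w) \<le> 1\<close> forces the Taylor remainder \<open>exp w - T w\<close> to have modulus at
  most \<open>2\<close>. The remainder is \<open>w ^ (n + 1) / fact n\<close> times the integral of \<open>(1 - t) ^ n * exp (t w)\<close>
  over \<open>0 \<le> t \<le> 1\<close>. As \<open>Re w \<le> 0\<close>, the modulus of the integrand is largest at \<open>t = 0\<close>, where its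
  logarithmic derivative is \<open>w - n\<close>, so the integral ought to be close to \<open>1 / (n - w)\<close>. An
  integration by parts makes this exact up to a relative error \<open>1 / (n + 1)\<close>, uniformly in the closed
  left half-plane; this is \<open>exp_taylor_remainder_left_half_plane\<close>.

  Hence \<open>norm w ^ (n + 1) / fact n\<close> is at most of the order of \<open>n + norm w\<close>. With \<open>r = norm z\<close> and
  the weak Stirling bound \<open>fact n \<le> exp 1 * n * (n / exp 1) ^ n\<close> this reads
  \<open>(exp 1 * r) ^ n \<le> C * n * (1 + 1 / r)\<close>. When \<open>r > 1 / exp 1 + \<epsilon>\<close> the factor \<open>1 + 1 / r\<close> is
  bounded and \<open>exp 1 * r\<close> is bounded away from \<open>1\<close>, so exponential growth rules this out for
  large \<open>n\<close>, however large \<open>r\<close> is.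
\<close>

lemma exp_taylor_sum_has_field_derivative:
  fixes x :: "'a :: {real_normed_field}"
  shows "((\<lambda>x. \<Sum>k\<le>n. x ^ k / fact k) has_field_derivative (\<Sum>k\<le>n. x ^ k / fact k) - x ^ n / fact n)
    (at x within S)"
proof (induction n)
  case 0
  show ?case by simp
next
  case (Suc n)
  have "((\<lambda>x. x ^ Suc n / fact (Suc n)) has_field_derivative
      of_nat (Suc n) * x ^ n / fact (Suc n)) (at x within S)"
    by (rule derivative_eq_intros refl | simp del: of_nat_Suc power_Suc fact_Suc)+
  also have "of_nat (Suc n) * x ^ n / fact (Suc n) = x ^ n / fact n"
    by (simp del: of_nat_Suc)
  finally show ?case
    using DERIV_add[OF Suc] by fastforce
qed

text \<open>
  Differentiating \<open>H t = (n - w) * exp (t w) * T ((1 - t) w) + w ^ (n + 1) / fact n * (1 - t) ^ n * exp (t w)\<close>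
  makes all but one term cancel: \<open>H' t = - (n * t * (1 - t) ^ (n - 1)) * exp (t w) * w ^ (n + 1) / fact n\<close>.
  The left-hand side below is \<open>norm (H 1 - H 0)\<close>, and since \<open>norm (exp (t w)) \<le> 1\<close> it is bounded
  by \<open>norm w ^ (n + 1) / fact n\<close> times the increase of a primitive of \<open>n * t * (1 - t) ^ (n - 1)\<close>
  over the unit interval, which is \<open>1 / (n + 1)\<close>.
\<close>

lemma exp_taylor_remainder_left_half_plane:
  fixes w :: complex
  assumes n: "n > 0" and w: "Re w \<le> 0"
  shows "norm ((of_nat n - w) * (exp w - (\<Sum>k\<le>n. w ^ k / fact k)) - w ^ Suc n / fact n)
    \<le> norm w ^ Suc n / fact n / (n + 1)"
proof -
  obtain m where m: "n = Suc m"
    using n gr0_conv_Suc by auto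
  define c where "c = w ^ Suc n / fact n"
  define T where "T = (\<lambda>x::complex. \<Sum>k\<le>n. x ^ k / fact k)"
  define H where "H = (\<lambda>t. (of_nat n - w) * exp (t * w) * T ((1 - t) * w) + c * (1 - t) ^ n * exp (t * w))"
  define H' where "H' = (\<lambda>t::complex. - (of_nat n * t * (1 - t) ^ m * exp (t * w) * c))"
  define \<phi> where "\<phi> = (\<lambda>t::real. norm c * (- (t * (1 - t) ^ n) - (1 - t) ^ Suc n / (n + 1)))"
  define \<phi>' where "\<phi>' = (\<lambda>t::real. norm c * (n * t * (1 - t) ^ m))"
  have dT: "(T has_field_derivative T x - x ^ n / fact n) (at x within S)" for x S
    unfolding T_def by (rule exp_taylor_sum_has_field_derivative)
  have dH: "(H has_field_derivative H' t) (at t)" for t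
  proof -
    have dTw: "((\<lambda>t. T ((1 - t) * w)) has_field_derivative
        (T ((1 - t) * w) - ((1 - t) * w) ^ n / fact n) * (- w)) (at t)"
      by (rule DERIV_chain2[OF dT]) (rule derivative_eq_intros refl | simp)+
    have dpow: "((\<lambda>t. (1 - t) ^ n) has_field_derivative - (of_nat n * (1 - t) ^ m)) (at t)"
      unfolding m by (rule derivative_eq_intros refl | simp)+
    have dexp: "((\<lambda>t. exp (t * w)) has_field_derivative exp (t * w) * w) (at t)"
      by (rule derivative_eq_intros refl | simp)+
    define X where "X = ((1 - t) * w) ^ n / fact n"
    have X: "w * X = c * ((1 - t) * (1 - t) ^ m)"
      by (simp add: X_def c_def m power_mult_distrib)
    have "(H has_field_derivative
        (of_nat n - w) * (exp (t * w) * w) * T ((1 - t) * w)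
        + (T ((1 - t) * w) - X) * (- w) * ((of_nat n - w) * exp (t * w))
        + (c * (- (of_nat n * (1 - t) ^ m)) * exp (t * w) + exp (t * w) * w * (c * (1 - t) ^ n))) (at t)"
      unfolding H_def X_def by (intro DERIV_add DERIV_mult DERIV_cmult dexp dTw dpow)
    also have "(of_nat n - w) * (exp (t * w) * w) * T ((1 - t) * w)
        + (T ((1 - t) * w) - X) * (- w) * ((of_nat n - w) * exp (t * w))
        + (c * (- (of_nat n * (1 - t) ^ m)) * exp (t * w) + exp (t * w) * w * (c * (1 - t) ^ n))
        = (of_nat n - w) * exp (t * w) * (w * X)
        - of_nat n * c * (1 - t) ^ m * exp (t * w) + exp (t * w) * w * c * ((1 - t) * (1 - t) ^ m)"
      by (simp add: m algebra_simps)
    also have "\<dots> = H' t"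
      unfolding X H'_def by (simp add: algebra_simps)
    finally show ?thesis .
  qed
  have dHr: "((\<lambda>t::real. H (of_real t)) has_vector_derivative H' (of_real t)) (at t within S)" for t S
    using has_vector_derivative_real_field[OF dH] has_vector_derivative_at_within by blast
  have d\<phi>: "(\<phi> has_vector_derivative \<phi>' t) (at t within S)" for t S
  proof -
    have dpow: "((\<lambda>t. (1 - t) ^ Suc k) has_real_derivative - (real (Suc k) * (1 - t) ^ k)) (at t within S)" for k
      by (rule derivative_eq_intros refl | simp)+
    have "(\<phi> has_real_derivative norm c * (- (1 * (1 - t) ^ n + - (n * (1 - t) ^ m) * t)
        - - (real (Suc n) * (1 - t) ^ n) / (n + 1))) (at t within S)"
      unfolding \<phi>_def m
      by (intro DERIV_cmult DERIV_diff DERIV_minus DERIV_mult DERIV_cdivide dpow DERIV_ident)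
    also have "norm c * (- (1 * (1 - t) ^ n + - (n * (1 - t) ^ m) * t)
        - - (real (Suc n) * (1 - t) ^ n) / (n + 1)) = \<phi>' t"
      by (simp add: \<phi>'_def add.commute)
    finally have "(\<phi> has_real_derivative \<phi>' t) (at t within S)" .
    then show ?thesis
      by (simp add: has_real_derivative_iff_has_vector_derivative)
  qed
  have bound: "norm (H' (of_real t)) \<le> \<phi>' t" if "0 < t" "t < 1" for t :: real
  proof -
    have "norm (1 - complex_of_real t) = 1 - t"
      using that by (metis abs_of_pos diff_gt_0_iff_gt norm_of_real of_real_1 of_real_diff)
    then have "norm (H' (of_real t)) = \<phi>' t * exp (t * Re w)"
      using that by (simp add: H'_def \<phi>'_def norm_mult norm_power)
    also have "\<dots> \<le> \<phi>' t * 1"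
    proof (rule mult_left_mono)
      show "exp (t * Re w) \<le> 1"
        using that w by (simp add: mult_nonneg_nonpos)
      show "0 \<le> \<phi>' t"
        using that by (simp add: \<phi>'_def)
    qed
    finally show ?thesis by simp
  qed
  have "norm (H (of_real 1) - H (of_real 0)) \<le> \<phi> 1 - \<phi> 0"
  proof (rule differentiable_bound_general[OF zero_less_one])
    show "continuous_on {0..1} \<phi>"
      by (rule continuous_on_vector_derivative) (rule d\<phi>)
    show "continuous_on {0..1} (\<lambda>t. H (complex_of_real t))"
      by (rule continuous_on_vector_derivative) (rule dHr)
  qed (use dHr d\<phi> bound in auto)
  moreover have "H (of_real 1) = (of_nat n - w) * exp w"
  proof -
    have "T 0 = 1"
      unfolding T_def by (simp add: power_0_left if_distrib[of "\<lambda>x. x / _"] cong: if_cong)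
    then show ?thesis
      by (simp add: H_def m)
  qed
  moreover have "H (of_real 0) = (of_nat n - w) * T w + c"
    by (simp add: H_def)
  moreover have "\<phi> 1 - \<phi> 0 = norm c / (n + 1)"
    by (simp add: \<phi>_def m)
  ultimately have "norm ((of_nat n - w) * (exp w - T w) - c) \<le> norm c / (n + 1)"
    by (simp only: right_diff_distrib diff_diff_eq)
  then show ?thesis
    by (simp only: c_def T_def norm_divide norm_power norm_fact)
qed

text \<open>
  A form of \<open>fact n \<le> exp 1 * n * (n / exp 1) ^ n\<close>. The factor \<open>n\<close> in place of the square root in
  Stirling's formula makes the induction step the inequality \<open>exp 1 \<le> (1 + 1 / n) ^ (n + 1)\<close>.
\<close>

lemma fact_mult_exp_le:
  assumes "n > 0"
  shows "fact n * exp 1 ^ n \<le> exp 1 * real n ^ Suc n"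
  using assms
proof (induction n rule: nat_induct_non_zero)
  case 1
  show ?case by simp
next
  case (Suc n)
  \<comment> \<open>The inequality \<open>exp 1 \<le> (1 + 1 / n) ^ (n + 1)\<close> in reciprocal form.\<close>
  have "real n / real (Suc n) \<le> exp (- 1 / real (Suc n))"
    using exp_ge_add_one_self[of "- 1 / real (Suc n)"] by (simp add: field_simps)
  then have "(real n / real (Suc n)) ^ Suc n \<le> exp (- 1 / real (Suc n)) ^ Suc n"
    by (intro power_mono) auto
  also have "\<dots> = exp (- 1)"
    by (subst exp_of_nat_mult[symmetric]) simp
  finally have step: "exp 1 * real n ^ Suc n \<le> real (Suc n) ^ Suc n"
    by (simp add: power_divide exp_minus field_simps del: power_Suc of_nat_Suc)
  have "fact (Suc n) * exp 1 ^ Suc n = real (Suc n) * exp 1 * (fact n * exp 1 ^ n)"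
    by simp
  also have "\<dots> \<le> real (Suc n) * exp 1 * (exp 1 * real n ^ Suc n)"
    using Suc.IH by (intro mult_left_mono) auto
  also have "\<dots> \<le> real (Suc n) * exp 1 * real (Suc n) ^ Suc n"
    using step by (intro mult_left_mono) auto
  finally show ?case
    by (simp add: mult_ac)
qed

text \<open>
  With \<open>w = n z\<close>, in the left half of the stability region the remainder estimate bounds \<open>norm w ^ (n + 1) / fact n\<close> by
  \<open>2 * norm (n - w)\<close> plus at most half of itself. Keeping the surplus factor \<open>norm z\<close> on the left
  makes both sides comparable for large \<open>z\<close>, so one inequality serves all moduli.
\<close>

lemma stability_region_left_half_plane_growth:
  assumes n: "n > 0" and z: "z \<in> stability_region n" "Re z \<le> 0"
  shows "norm z * (exp 1 * norm z) ^ n \<le> 4 * exp 1 * n * (1 + norm z)"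
proof -
  define w where "w = of_nat n * z"
  define T where "T = (\<Sum>k\<le>n. w ^ k / fact k)"
  define a where "a = norm w ^ Suc n / fact n"
  have w: "Re w \<le> 0"
    using z by (simp add: w_def mult_nonneg_nonpos)
  have "norm T \<le> 1"
    using z by (simp add: T_def w_def stability_region_def scaled_taylor_def atMost_atLeast0)
  moreover have "norm (exp w) \<le> 1"
    using w by simp
  ultimately have R: "norm (exp w - T) \<le> 2"
    using norm_triangle_ineq4[of "exp w" T] by linarith
  have "a = norm (w ^ Suc n / fact n)"
    by (simp add: a_def norm_divide norm_power norm_mult)
  also have "\<dots> \<le> norm ((of_nat n - w) * (exp w - T))
      + norm ((of_nat n - w) * (exp w - T) - w ^ Suc n / fact n)"
    by (metis norm_triangle_sub norm_minus_commute)
  also have "\<dots> \<le> (n + norm w) * 2 + a / (n + 1)"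
  proof (rule add_mono)
    have "norm (of_nat n - w) \<le> n + norm w"
      using norm_triangle_ineq4[of "of_nat n" w] by simp
    then show "norm ((of_nat n - w) * (exp w - T)) \<le> (n + norm w) * 2"
      using R unfolding norm_mult by (intro mult_mono) auto
  qed (use exp_taylor_remainder_left_half_plane[OF n w] in \<open>simp add: a_def T_def\<close>)
  also have "a / (n + 1) \<le> a / 2"
    using n by (intro divide_left_mono) (auto simp: a_def)
  finally have "a \<le> 4 * (n + norm w)"
    by simp
  then have a: "norm w ^ Suc n \<le> 4 * (n + norm w) * fact n"
    by (simp add: a_def field_simps)
  have "real n ^ Suc n * (norm z * (exp 1 * norm z) ^ n) = norm w ^ Suc n * exp 1 ^ n"
    by (simp add: w_def norm_mult power_mult_distrib)
  also have "\<dots> \<le> 4 * (n + norm w) * fact n * exp 1 ^ n"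
    by (intro mult_right_mono a) auto
  also have "\<dots> = 4 * (n + norm w) * (fact n * exp 1 ^ n)"
    by simp
  also have "\<dots> \<le> 4 * (n + norm w) * (exp 1 * real n ^ Suc n)"
    by (intro mult_left_mono fact_mult_exp_le n) auto
  also have "\<dots> = real n ^ Suc n * (4 * exp 1 * n * (1 + norm z))"
    by (simp add: w_def norm_mult algebra_simps)
  finally show ?thesis
    using n by (simp del: power_Suc)
qed

theorem theorem3p1:
  fixes \<epsilon> :: real
  assumes "\<epsilon> > 0"
  shows "\<exists>n0::nat. n0 > 0 \<and> (\<forall>n\<ge>n0.
    stability_region n \<inter> {z. Re z \<le> 0} \<subseteq> cball 0 (1 / exp 1 + \<epsilon>) \<inter> {z. Re z \<le> 0})"
proof -
  define q where "q = exp 1 * (1 / exp 1 + \<epsilon>)"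
  define C :: real where "C = 4 * exp 1 * (exp 1 + 1)"
  have q: "q > 1"
    using assms by (simp add: q_def distrib_left)
  have C: "C > 0"
    by (simp add: C_def add_pos_pos)
  have "(\<lambda>n. of_nat n * inverse q ^ n) \<longlonglongrightarrow> 0"
    by (rule powser_times_n_limit_0) (use q in \<open>simp add: inverse_less_1_iff\<close>)
  moreover have "1 / C > 0"
    using C by simp
  ultimately have "\<forall>\<^sub>F n in sequentially. real n * inverse q ^ n < 1 / C"
    by (rule order_tendstoD(2))
  then obtain N where N: "\<And>n. n \<ge> N \<Longrightarrow> real n * inverse q ^ n < 1 / C"
    unfolding eventually_sequentially by blast
  have "norm z \<le> 1 / exp 1 + \<epsilon>"
    if n: "n \<ge> Suc N" and z: "z \<in> stability_region n" "Re z \<le> 0" for n z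
  proof (rule ccontr)
    assume "\<not> ?thesis"
    then have r: "norm z > 1 / exp 1 + \<epsilon>" by simp
    then have r': "1 / exp 1 < norm z"
      using assms by linarith
    then have r0: "norm z > 0"
      by (metis exp_gt_zero less_trans zero_less_divide_1_iff)
    have "q ^ n \<le> (exp 1 * norm z) ^ n"
      using q r by (intro power_mono) (auto simp: q_def)
    then have "norm z * q ^ n \<le> norm z * (exp 1 * norm z) ^ n"
      by (rule mult_left_mono) simp
    also have "\<dots> \<le> 4 * exp 1 * n * (1 + norm z)"
      using n z by (intro stability_region_left_half_plane_growth) auto
    also have "\<dots> \<le> 4 * exp 1 * n * (norm z * (exp 1 + 1))"
    proof -
      have "1 \<le> norm z * exp 1"
        using r' by (simp add: field_simps)
      then show ?thesis
        by (intro mult_left_mono) (auto simp: algebra_simps)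
    qed
    also have "\<dots> = norm z * (C * n)"
      by (simp add: C_def)
    finally have "q ^ n \<le> C * n"
      using r0 by simp
    moreover have "C * n < q ^ n"
      using N[of n] n q C by (simp add: power_inverse field_simps)
    ultimately show False by simp
  qed
  then show ?thesis
    by (intro exI[of _ "Suc N"]) auto
qed

end
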